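(* Let $n$ and $r$ be integers with $1\leq r\leq n-1$. Then $$\binom{2n}{n}=\sum_{i=0}^n\binom{2n-r-1-i}{n-r-1}P_{i+1}^{(r)},$$ where $P_{k}^{(r)}=\binom{k+r-1}{r}$, so that $P_{i+1}^{(r)}=\binom{i+r}{r}$.
   Context: The numbers $P_k^{(r)}$ (for integers $k\ge1$, $r\ge1$) are defined by $P_k^{(1)}=k$ and $P_k^{(r)}=\sum_{i=1}^kP_i^{(r-1)}$ for $r\ge2$; equivalently $P_k^{(r)}=\frac{k(k+1)\cdots(k+r-1)}{r!}=\binom{k+r-1}{r}$. ($P_k^{(2)}$ are the triangular numbers and $P_k^{(3)}$ the tetrahedral numbers.) *)

theory Defs
  imports Main
begin

text \<open>
  \<open>P r k\<close> stands for \<open>P\<^sub>k\<^sup>(\<^sup>r\<^sup>)\<close>. The numbers are only of interest for \<open>r \<ge> 1\<close> and \<open>k \<ge> 1\<close>;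
  the value at \<open>r = 0\<close> is a convention, chosen so that the closed form below holds there as well.
\<close>

fun P :: "nat \<Rightarrow> nat \<Rightarrow> nat" where
  "P 0 k = 1"
| "P (Suc 0) k = k"
| "P (Suc (Suc r)) k = (\<Sum>i = 1..k. P (Suc r) i)"

lemma P_Suc_eq_binomial: "P r (Suc i) = (i + r) choose r"
proof (induction r "Suc i" arbitrary: i rule: P.induct)
  case (3 r)
  have "P (Suc (Suc r)) (Suc i) = (\<Sum>j = 0..i. P (Suc r) (Suc j))"
    by (simp only: P.simps One_nat_def sum.shift_bounds_cl_Suc_ivl)
  also have "\<dots> = (\<Sum>j = 0..i. (j + Suc r) choose (Suc r))"
    by (intro sum.cong refl 3) auto
  also have "\<dots> = (i + Suc (Suc r)) choose (Suc (Suc r))"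
    by (induction i) auto
  finally show ?case .
qed auto

lemma P_eq_binomial: "k \<ge> 1 \<Longrightarrow> P r k = (k + r - 1) choose r"
  by (cases k) (auto simp: P_Suc_eq_binomial)

end

theory Submission
  imports Defs
begin

text \<open>
  Since \<open>P r (i + 1) = (i + r) choose r\<close>, the claim is the case \<open>a = n - r - 1\<close>, \<open>m = n\<close> of
  the upper-index Vandermonde convolution \<open>sum_choose_mult_choose\<close>. That convolution
  expresses that the coefficients of \<open>1 / (1 - x)^(a + 1)\<close> and \<open>1 / (1 - x)^(r + 1)\<close> convolve to
  those of \<open>1 / (1 - x)^(a + r + 2)\<close>; counting the \<open>(a + r + 1)\<close>-subsets of a chain according to
  the position of their \<open>(r + 1)\<close>-st smallest element gives it as well. The proof below is by
  Pascal's rule: both sides, viewed as functions of \<open>r\<close> and \<open>m\<close>, satisfy the same recurrence.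
\<close>

lemma sum_choose_mult_choose:
  fixes a r m :: nat
  shows "(\<Sum>i\<le>m. ((a + m - i) choose a) * ((i + r) choose r)) =
    (a + r + m + 1) choose (a + r + 1)"
proof (induction r arbitrary: m)
  case 0
  show ?case
    by (induction m) (simp_all add: sum.atMost_Suc_shift del: sum.atMost_Suc)
next
  case (Suc r)
  note IH_r = Suc.IH
  show ?case
  proof (induction m)
    case 0
    show ?case by simp
  next
    case (Suc m)
    let ?c = "\<lambda>i. (a + Suc m - i) choose a"
    \<comment> \<open>At \<open>i = 0\<close> the second summand of Pascal's rule vanishes, so its sum starts at 1 and is the
      sum for \<open>m\<close> after a shift of the index.\<close>
    have "(\<Sum>i\<le>Suc m. ?c i * ((i + Suc r) choose Suc r)) =
        (\<Sum>i\<le>Suc m. ?c i * ((i + r) choose r)) + (\<Sum>i\<le>Suc m. ?c i * ((i + r) choose Suc r))"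
      by (simp only: add_Suc_right binomial_Suc_Suc distrib_left sum.distrib)
    also have "(\<Sum>i\<le>Suc m. ?c i * ((i + r) choose Suc r)) =
        (\<Sum>i\<le>m. ((a + m - i) choose a) * ((i + Suc r) choose Suc r))"
      by (simp add: sum.atMost_Suc_shift del: sum.atMost_Suc binomial_Suc_Suc)
    also have "\<dots> = (a + Suc r + m + 1) choose (a + Suc r + 1)"
      by (rule Suc.IH)
    also have "(\<Sum>i\<le>Suc m. ?c i * ((i + r) choose r)) =
        (a + r + Suc m + 1) choose (a + r + 1)"
      by (rule IH_r)
    finally show ?case by simp
  qed
qed

theorem proposition3p6:
  fixes n r :: nat
  assumes "1 \<le> r" and "r \<le> n - 1"
  shows "(2 * n) choose n =
    (\<Sum>i = 0..n. ((2 * n - r - 1 - i) choose (n - r - 1)) * P r (i + 1))"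
proof -
  from assms have "r < n" by simp
  then obtain a where n: "n = a + r + 1"
    using less_imp_Suc_add[of r n] by auto
  have "(\<Sum>i = 0..n. ((2 * n - r - 1 - i) choose (n - r - 1)) * P r (i + 1)) =
      (\<Sum>i\<le>n. ((a + n - i) choose a) * ((i + r) choose r))"
    by (intro sum.cong) (auto simp: n P_Suc_eq_binomial mult_2)
  also have "\<dots> = (a + r + n + 1) choose (a + r + 1)"
    by (rule sum_choose_mult_choose)
  also have "a + r + n + 1 = 2 * n"
    by (simp add: n)
  also have "a + r + 1 = n"
    by (simp only: n)
  finally show ?thesis
    by (rule sym)
qed

end
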